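(* Let $\varphi,\psi$ be two linear fractional self-maps of $\mathbb{D}$, both different from the identity, and let $f$ be a self-map of $\mathbb{D}$ which is conformal at $p$, where $p$ is the Denjoy-Wolff point of $\varphi$. Assume that $f\circ\varphi=\psi\circ f$ on $\mathbb{D}$. Then: (a) If $\varphi$ is elliptic non-automorphic, then $\psi$ is also elliptic non-automorphic. (b) If $\psi$ is elliptic non-automorphic, then $\varphi$ is either a hyperbolic map or an elliptic non-automorphic map. (c) $\varphi$ is an elliptic automorphism if and only if $\psi$ is also an elliptic automorphism. (d) If $\psi$ is hyperbolic, then $\varphi$ is also hyperbolic. (e) If $\varphi$ is hyperbolic, then $\psi$ is either a hyperbolic or an elliptic non-automorphic map. Moreover, if $\varphi$ is a hyperbolic automorphism, then $\psi$ is either a hyperbolic automorphism or an elliptic non-automorphic map such that $\overline{\psi(\mathbb{D})}\cap\partial\mathbb{D}\neq\emptyset$. (f) $\varphi$ is parabolic non-automorphic if and only if $\psi$ is also parabolic non-automorphic. (g) $\varphi$ is a parabolic automorphism if and only if $\psi$ is also a parabolic automorphism.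
   Context: $\mathbb{D}$ is the open unit disk in $\mathbb{C}$. A self-map of $\mathbb{D}$ is a function analytic in $\mathbb{D}$ with $f(\mathbb{D})\subset\mathbb{D}$. A linear fractional self-map is a self-map of $\mathbb{D}$ of the form $z\mapsto (az+b)/(cz+d)$ with $ad-bc\ne0$. An automorphism is a bijective self-map of $\mathbb{D}$; non-automorphic means not an automorphism. Denjoy-Wolff point of a non-identity self-map $g$ of $\mathbb{D}$: if $g$ has a fixed point in $\mathbb{D}$ (necessarily unique), it is that point (also when $g$ is an automorphism), and $g$ is called elliptic; otherwise it is the unique point $p\in\partial\mathbb{D}$ to which the iterates of $g$ converge uniformly on compact subsets of $\mathbb{D}$, and then $g$ is called hyperbolic if its (angular) derivative satisfies $g'(p)<1$ and parabolic if $g'(p)=1$ (always $0<g'(p)\le1$). The symbol $\angle\lim$ denotes the angular (non-tangential) limit. A self-map $f$ of $\mathbb{D}$ is conformal at $p\in\partial\mathbb{D}$ if the angular limits $q=\angle\lim_{z\to p}f(z)\in\overline{\mathbb{D}}$ and $\angle\lim_{z\to p}\frac{f(z)-q}{z-p}$ exist and the latter is different from $0$ and $\infty$. If $p\in\mathbb{D}$, conformal at $p$ means $f'(p)\ne0$. *)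

theory Defs
  imports "HOL-Complex_Analysis.Complex_Analysis"
begin

abbreviation unit_disc :: "complex set" where
  "unit_disc \<equiv> ball 0 1"

text \<open>
  Maps of the disc are represented by total functions on the complex numbers; only their values on
  \<^term>\<open>unit_disc\<close> matter. In particular all boundary notions below are defined by limits from
  within the disc, and being the identity means being the identity on the disc.
\<close>

definition self_map :: "(complex \<Rightarrow> complex) \<Rightarrow> bool" where
  "self_map g \<longleftrightarrow> g holomorphic_on unit_disc \<and> g ` unit_disc \<subseteq> unit_disc"

definition non_identity :: "(complex \<Rightarrow> complex) \<Rightarrow> bool" where
  "non_identity g \<longleftrightarrow> (\<exists>z\<in>unit_disc. g z \<noteq> z)"

text \<open>
  The denominator is required not to vanish on the disc so that the convention \<open>x / 0 = 0\<close> plays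
  no role.
\<close>

definition linear_fractional_self_map :: "(complex \<Rightarrow> complex) \<Rightarrow> bool" where
  "linear_fractional_self_map g \<longleftrightarrow> self_map g \<and>
     (\<exists>a b c d. a * d - b * c \<noteq> 0 \<and>
        (\<forall>z\<in>unit_disc. c * z + d \<noteq> 0 \<and> g z = (a * z + b) / (c * z + d)))"

definition disc_automorphism :: "(complex \<Rightarrow> complex) \<Rightarrow> bool" where
  "disc_automorphism g \<longleftrightarrow> self_map g \<and> bij_betw g unit_disc unit_disc"

text \<open>
  Non-tangential approach regions at a boundary point \<open>p\<close>. Every angular sector at \<open>p\<close>, symmetric
  about the radius and of opening less than \<open>\<pi>\<close>, is contained near \<open>p\<close> in such a region, and every
  such region is contained in such a sector, so they give the usual angular limits.
\<close>

definition stolz_region :: "complex \<Rightarrow> real \<Rightarrow> complex set" where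
  "stolz_region p M = {z \<in> unit_disc. norm (z - p) < M * (1 - norm z)}"

definition angular_tendsto :: "(complex \<Rightarrow> complex) \<Rightarrow> complex \<Rightarrow> complex \<Rightarrow> bool" where
  "angular_tendsto g l p \<longleftrightarrow> (\<forall>M>1. (g \<longlongrightarrow> l) (at p within stolz_region p M))"

definition has_angular_derivative :: "(complex \<Rightarrow> complex) \<Rightarrow> complex \<Rightarrow> complex \<Rightarrow> bool" where
  "has_angular_derivative g D p \<longleftrightarrow>
     (\<exists>q\<in>cball 0 1. angular_tendsto g q p \<and> angular_tendsto (\<lambda>z. (g z - q) / (z - p)) D p)"

definition conformal_at :: "(complex \<Rightarrow> complex) \<Rightarrow> complex \<Rightarrow> bool" where
  "conformal_at f p \<longleftrightarrow>
     (p \<in> unit_disc \<and> deriv f p \<noteq> 0) \<or>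
     (p \<in> sphere 0 1 \<and> (\<exists>D. D \<noteq> 0 \<and> has_angular_derivative f D p))"

definition elliptic :: "(complex \<Rightarrow> complex) \<Rightarrow> bool" where
  "elliptic g \<longleftrightarrow> self_map g \<and> non_identity g \<and> (\<exists>z\<in>unit_disc. g z = z)"

definition denjoy_wolff_point :: "(complex \<Rightarrow> complex) \<Rightarrow> complex \<Rightarrow> bool" where
  "denjoy_wolff_point g p \<longleftrightarrow> self_map g \<and> non_identity g \<and>
     (if \<exists>z\<in>unit_disc. g z = z
      then p \<in> unit_disc \<and> g p = p
      else p \<in> sphere 0 1 \<and>
           (\<forall>K. compact K \<and> K \<subseteq> unit_disc \<longrightarrow>
              uniform_limit K (\<lambda>n. g ^^ n) (\<lambda>_. p) sequentially))"

definition hyperbolic :: "(complex \<Rightarrow> complex) \<Rightarrow> bool" where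
  "hyperbolic g \<longleftrightarrow> self_map g \<and> non_identity g \<and> \<not> elliptic g \<and>
     (\<exists>p r. denjoy_wolff_point g p \<and> has_angular_derivative g (complex_of_real r) p \<and> r < 1)"

definition parabolic :: "(complex \<Rightarrow> complex) \<Rightarrow> bool" where
  "parabolic g \<longleftrightarrow> self_map g \<and> non_identity g \<and> \<not> elliptic g \<and>
     (\<exists>p. denjoy_wolff_point g p \<and> has_angular_derivative g 1 p)"

end

theory Submission
  imports Defs
begin

text \<open>
  Conformality of \<open>f\<close> makes the multiplier (the derivative at the Denjoy-Wolff point) pass from \<open>\<phi>\<close>
  to \<open>\<psi>\<close>: dividing \<open>f \<circ> \<phi> = \<psi> \<circ> f\<close>, recentred at \<open>p\<close> and at \<open>q = f(p)\<close>, by \<open>z - p\<close> and letting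
  \<open>z\<close> tend to \<open>p\<close> gives \<open>f'(p) \<phi>'(p) = \<psi>'(q) f'(p)\<close>, and \<open>f'(p) \<noteq> 0\<close>. The multiplier decides the
  type, and what it leaves open is settled by orbits.

  If \<open>\<phi>\<close> is elliptic, all this happens inside the disc, and by the Schwarz lemma a map with an
  interior fixed point is an automorphism exactly if its multiplier has modulus one
  (\<open>automorphism_iff_unimodular_multiplier\<close>).

  If \<open>\<phi>\<close> is not elliptic, the Cayley transform \<open>w = (p + z) / (p - z)\<close> sends \<open>p\<close> to infinity and the
  disc to the right half-plane, and \<open>\<phi>\<close> becomes an affine map \<open>w \<mapsto> A w + B\<close> with \<open>A > 0\<close> and
  \<open>Re B \<ge> 0\<close>. Its multiplier is \<open>1 / A\<close>; convergence of the iterates to \<open>p\<close> forces \<open>A \<ge> 1\<close>; the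
  map is hyperbolic for \<open>A > 1\<close>, parabolic for \<open>A = 1\<close>, and an automorphism exactly if \<open>Re B = 0\<close>.
  Transferring the multiplier (\<open>fixed_point_form\<close>) leaves two cases.

  If \<open>q\<close> lies in the disc, then \<open>\<psi>\<close> is elliptic with multiplier \<open>1 / A\<close>. This is not \<open>1\<close>, since
  \<open>\<psi>\<close> is not the identity, so \<open>A > 1\<close>. If moreover \<open>\<phi>\<close> is an automorphism, every point has
  preimages under all iterates of \<open>\<phi>\<close>, hence every value of \<open>f\<close> has them under all iterates of
  \<open>\<psi>\<close>. Were the image of \<open>\<psi>\<close> relatively compact, \<open>\<psi>\<close> would contract uniformly towards \<open>q\<close>, and
  only \<open>q\<close> would have such preimages (\<open>backward_orbit_at_fixed_point\<close>); \<open>f\<close> would be constant.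

  If \<open>q\<close> lies on the circle, then \<open>\<psi>\<close> is affine in its own half-plane, \<open>w \<mapsto> A w + B'\<close> with the
  same \<open>A\<close>, so the types agree. It remains to compare \<open>Re B\<close> and \<open>Re B'\<close>. When \<open>\<phi>\<close> is an
  automorphism, backward orbits again give \<open>Re B' = 0\<close>, because \<open>n\<close> steps of \<open>\<psi>\<close> raise the real
  part by at least \<open>n Re B'\<close> (\<open>automorphism_transfer\<close>). When \<open>A = 1\<close> and \<open>Re B > 0\<close>, the orbits of
  \<open>\<phi>\<close> approach \<open>p\<close> non-tangentially, so the slope \<open>c\<close> of \<open>f\<close> at infinity in half-plane
  coordinates can be computed along them and equals \<open>B' / B\<close>; a half-plane map can only have a
  non-negative real slope, so \<open>c > 0\<close> and \<open>Re B' > 0\<close> (\<open>parabolic_non_automorphism_transfer\<close>).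
\<close>

section \<open>Fixed points inside the disc\<close>

lemma self_mapD: "self_map g \<Longrightarrow> z \<in> unit_disc \<Longrightarrow> g z \<in> unit_disc"
  unfolding self_map_def by blast

text \<open>
  Conjugating by a disc automorphism moves the fixed point to the centre, where the Schwarz lemma
  applies, and does not change the multiplier.
\<close>

lemma conjugate_to_origin:
  assumes "self_map g" "q \<in> unit_disc" "g q = q"
  defines "h \<equiv> Moebius_function 0 q \<circ> g \<circ> Moebius_function 0 (- q)"
  shows "h holomorphic_on unit_disc" "\<And>z. norm z < 1 \<Longrightarrow> norm (h z) < 1" "h 0 = 0" "deriv h 0 = deriv g q"
proof -
  define M where "M = Moebius_function 0 q"
  define N where "N = Moebius_function 0 (- q)"
  have q: "norm q < 1" "norm (- q) < 1" using assms by auto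
  have g: "g holomorphic_on unit_disc" "g ` unit_disc \<subseteq> unit_disc"
    using assms by (auto simp: self_map_def)
  have M: "M holomorphic_on unit_disc" "M ` unit_disc \<subseteq> unit_disc"
    and N: "N holomorphic_on unit_disc" "N ` unit_disc \<subseteq> unit_disc"
    unfolding M_def N_def
    using Moebius_function_holomorphic Moebius_function_norm_lt_1 q by auto
  have MN: "M (N z) = z" if "z \<in> unit_disc" for z
    unfolding M_def N_def using that q by (intro Moebius_function_compose) auto
  have gN: "g \<circ> N holomorphic_on unit_disc"
    using holomorphic_on_compose_gen[OF N(1) g(1) N(2)] .
  have gN': "(g \<circ> N) ` unit_disc \<subseteq> unit_disc" using g(2) N(2) by fastforce
  have h: "h = M \<circ> (g \<circ> N)" by (simp add: h_def M_def N_def comp_assoc)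
  show "h holomorphic_on unit_disc"
    unfolding h by (rule holomorphic_on_compose_gen[OF gN M(1) gN'])
  have "h ` unit_disc \<subseteq> unit_disc" unfolding h using gN' M(2) by fastforce
  then show "norm (h z) < 1" if "norm z < 1" for z using that by (auto simp: subset_iff)
  have N0: "N 0 = q" by (simp add: N_def Moebius_function_of_zero)
  show "h 0 = 0" using assms(3) by (simp add: h N0 M_def Moebius_function_eq_zero)
  have diff: "k field_differentiable at z" if "k holomorphic_on unit_disc" "z \<in> unit_disc" for k z
    using that by (auto intro: holomorphic_on_imp_differentiable_at)
  have "deriv (M \<circ> N) 0 = deriv M q * deriv N 0"
    using deriv_chain[of N 0 M] diff[OF N(1), of 0] diff[OF M(1), of q] q N0 by simp
  moreover have "deriv (M \<circ> N) 0 = deriv (\<lambda>z. z) 0"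
    using MN by (intro complex_derivative_transform_within_open[of _ unit_disc])
      (auto intro!: holomorphic_on_compose_gen[OF N(1) M(1) N(2)])
  ultimately have 1: "deriv M q * deriv N 0 = 1" by simp
  have "deriv (g \<circ> N) 0 = deriv g q * deriv N 0"
    using deriv_chain[of N 0 g] diff[OF N(1), of 0] diff[OF g(1), of q] q N0 by simp
  moreover have "deriv h 0 = deriv M q * deriv (g \<circ> N) 0"
    using deriv_chain[of "g \<circ> N" 0 M] diff[OF gN, of 0] diff[OF M(1), of q] q N0 assms(3)
    by (simp add: h)
  ultimately show "deriv h 0 = deriv g q" using 1 by (simp add: algebra_simps)
qed

lemma conjugate_from_origin:
  assumes "q \<in> unit_disc" "z \<in> unit_disc"
  shows "(Moebius_function 0 q \<circ> g \<circ> Moebius_function 0 (- q)) (Moebius_function 0 q z)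
     = Moebius_function 0 q (g z)"
  using assms Moebius_function_compose[of "- q" q z] by simp

lemma Moebius_function_inj:
  assumes "q \<in> unit_disc" "z \<in> unit_disc" "w \<in> unit_disc"
    and "Moebius_function 0 q z = Moebius_function 0 q w"
  shows "z = w"
  using assms Moebius_function_compose[of "- q" q] by (metis mem_ball_0 minus_minus norm_minus_cancel)

lemma norm_deriv_fixed_point_le_1:
  assumes "self_map g" "q \<in> unit_disc" "g q = q"
  shows "norm (deriv g q) \<le> 1"
proof -
  note c = conjugate_to_origin[OF assms]
  show ?thesis using Schwarz_Lemma(2)[OF c(1,3,2), of 0] c(4) by (simp del: o_apply)
qed

text \<open>
  The equality case of the Schwarz lemma, stated for a fixed point away from the centre.
\<close>

lemma rotation_if_unimodular_multiplier:
  assumes "self_map g" "q \<in> unit_disc" "g q = q" "norm (deriv g q) = 1"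
  obtains \<alpha> where "norm \<alpha> = 1" "\<alpha> = deriv g q"
    "\<And>z. z \<in> unit_disc \<Longrightarrow> Moebius_function 0 q (g z) = \<alpha> * Moebius_function 0 q z"
proof -
  note c = conjugate_to_origin[OF assms(1-3)]
  define h where "h = Moebius_function 0 q \<circ> g \<circ> Moebius_function 0 (- q)"
  have "\<exists>\<alpha>. (\<forall>z. norm z < 1 \<longrightarrow> h z = \<alpha> * z) \<and> norm \<alpha> = 1"
    unfolding h_def using Schwarz_Lemma(3)[OF c(1,3,2), of 0] c(4) assms(4) by (simp del: o_apply)
  then obtain \<alpha> where \<alpha>: "\<And>z. norm z < 1 \<Longrightarrow> h z = \<alpha> * z" "norm \<alpha> = 1" by blast
  have "deriv h 0 = deriv (\<lambda>z. \<alpha> * z) 0"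
    using \<alpha>(1) c(1) by (intro complex_derivative_transform_within_open[of _ unit_disc])
      (auto simp: h_def intro!: holomorphic_intros)
  then have "\<alpha> = deriv g q" using c(4) by (simp add: h_def)
  moreover have "Moebius_function 0 q (g z) = \<alpha> * Moebius_function 0 q z" if "z \<in> unit_disc" for z
    using \<alpha>(1)[of "Moebius_function 0 q z"] conjugate_from_origin[OF assms(2) that]
      Moebius_function_norm_lt_1[of q z 0] assms(2) that by (simp add: h_def)
  ultimately show ?thesis using \<alpha>(2) that by blast
qed

lemma automorphism_iff_unimodular_multiplier:
  assumes "self_map g" "q \<in> unit_disc" "g q = q"
  shows "disc_automorphism g \<longleftrightarrow> norm (deriv g q) = 1"
proof
  assume aut: "disc_automorphism g"
  have g: "g holomorphic_on unit_disc" "g ` unit_disc = unit_disc" "inj_on g unit_disc"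
    using aut by (auto simp: disc_automorphism_def self_map_def bij_betw_def)
  obtain k where k: "k holomorphic_on g ` unit_disc"
      "\<And>z. z \<in> unit_disc \<Longrightarrow> deriv g z * deriv k (g z) = 1" "\<And>z. z \<in> unit_disc \<Longrightarrow> k (g z) = z"
    using holomorphic_has_inverse[OF g(1) _ g(3)] by auto
  have "k ` unit_disc \<subseteq> unit_disc"
  proof
    fix y assume "y \<in> k ` unit_disc"
    then obtain z where "z \<in> unit_disc" "y = k (g z)" using g(2) by (metis imageE)
    then show "y \<in> unit_disc" using k(3) by simp
  qed
  then have "self_map k" using k(1) g(2) by (simp add: self_map_def)
  then have "norm (deriv k q) \<le> 1"
    using norm_deriv_fixed_point_le_1[of k q] k(3)[of q] assms by simp
  \<comment> \<open>Both \<open>g\<close> and its inverse have multiplier of modulus at most 1, and the multipliers are reciprocal.\<close>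
  moreover have "norm (deriv g q) * norm (deriv k q) = 1"
    using k(2)[of q] assms by (metis norm_mult norm_one)
  moreover have "norm (deriv g q) \<le> 1" by (rule norm_deriv_fixed_point_le_1[OF assms])
  ultimately show "norm (deriv g q) = 1"
    by (metis mult_left_le norm_ge_zero order_antisym)
next
  assume "norm (deriv g q) = 1"
  then obtain \<alpha> where \<alpha>: "norm \<alpha> = 1"
      "\<And>z. z \<in> unit_disc \<Longrightarrow> Moebius_function 0 q (g z) = \<alpha> * Moebius_function 0 q z"
    using rotation_if_unimodular_multiplier[OF assms] by metis
  have gD: "g z \<in> unit_disc" if "z \<in> unit_disc" for z using assms(1) that by (rule self_mapD)
  have inj: "inj_on g unit_disc"
  proof (rule inj_onI)
    fix z w assume zw: "z \<in> unit_disc" "w \<in> unit_disc" "g z = g w"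
    then have "\<alpha> * Moebius_function 0 q z = \<alpha> * Moebius_function 0 q w" using \<alpha>(2) by metis
    then have "Moebius_function 0 q z = Moebius_function 0 q w" using \<alpha>(1) by auto
    then show "z = w" using Moebius_function_inj assms(2) zw by blast
  qed
  have "unit_disc \<subseteq> g ` unit_disc"
  proof
    fix y assume y: "y \<in> unit_disc"
    define u where "u = Moebius_function 0 q y / \<alpha>"
    have u: "norm u < 1"
      using Moebius_function_norm_lt_1[of q y 0] y assms(2) \<alpha>(1) by (simp add: u_def norm_divide)
    define z where "z = Moebius_function 0 (- q) u"
    have z: "z \<in> unit_disc"
      using Moebius_function_norm_lt_1[of "- q" u 0] u assms(2) by (simp add: z_def)
    have "Moebius_function 0 q z = u"
      unfolding z_def using assms(2) u by (intro Moebius_function_compose) auto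
    then have "Moebius_function 0 q (g z) = Moebius_function 0 q y"
      using \<alpha>(1) \<alpha>(2)[OF z] by (auto simp: u_def)
    then have "g z = y" using Moebius_function_inj assms(2) gD z y by blast
    then show "y \<in> g ` unit_disc" using z by blast
  qed
  then show "disc_automorphism g"
    using inj gD assms(1) by (auto simp: disc_automorphism_def bij_betw_def)
qed

lemma identity_if_multiplier_1:
  assumes "self_map g" "q \<in> unit_disc" "g q = q" "deriv g q = 1"
  shows "\<not> non_identity g"
proof -
  obtain \<alpha> where "\<alpha> = 1"
      "\<And>z. z \<in> unit_disc \<Longrightarrow> Moebius_function 0 q (g z) = \<alpha> * Moebius_function 0 q z"
    using rotation_if_unimodular_multiplier[OF assms(1-3)] assms(4) by (metis norm_one)
  then show ?thesis
    using Moebius_function_inj[OF assms(2)] assms(1) unfolding non_identity_def self_map_def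
    by (metis image_subset_iff mult_1)
qed

text \<open>
  If the image of \<open>g\<close> stays away from the unit circle, the conjugate \<open>h\<close> of \<open>g\<close> that fixes the
  centre maps the disc into a disc of radius \<open>k < 1\<close>. The Schwarz lemma for \<open>h / k\<close> makes \<open>h\<close> a
  contraction with factor \<open>k\<close>, so a point with preimages under all iterates can only be the fixed
  point.
\<close>

lemma backward_orbit_at_fixed_point:
  assumes "self_map g" "q \<in> unit_disc" "g q = q"
    and away: "closure (g ` unit_disc) \<inter> sphere 0 1 = {}"
    and u: "\<And>n. u n \<in> unit_disc" "\<And>n. (g ^^ n) (u n) = y"
  shows "y = q"
proof -
  define M where "M = Moebius_function 0 q"
  define h where "h = M \<circ> g \<circ> Moebius_function 0 (- q)"
  have h: "h holomorphic_on unit_disc" "h 0 = 0"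
    using conjugate_to_origin[OF assms(1-3)] by (simp_all add: h_def M_def)
  define K where "K = closure (g ` unit_disc)"
  have gD: "g ` unit_disc \<subseteq> unit_disc" using assms(1) by (simp add: self_map_def)
  have "K \<subseteq> cball 0 1"
    unfolding K_def using gD by (intro closure_minimal) auto
  then have KD: "K \<subseteq> unit_disc" using away by (force simp: K_def)
  have "bounded (g ` unit_disc)" using gD bounded_ball bounded_subset by blast
  then have Kc: "compact K" by (simp add: K_def compact_closure)
  have M: "M holomorphic_on unit_disc" "\<And>z. z \<in> unit_disc \<Longrightarrow> M z \<in> unit_disc"
    using Moebius_function_holomorphic[of q 0] Moebius_function_norm_lt_1[of q _ 0] assms(2)
    by (auto simp: M_def)
  have "continuous_on K (\<lambda>z. norm (M z))"
    using holomorphic_on_imp_continuous_on[OF M(1)] KD by (intro continuous_intros) (rule continuous_on_subset)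
  moreover have "K \<noteq> {}" unfolding K_def using closure_subset[of "g ` unit_disc"] assms(2) by fastforce
  ultimately obtain z0 where z0: "z0 \<in> K" "\<And>z. z \<in> K \<Longrightarrow> norm (M z) \<le> norm (M z0)"
    using continuous_attains_sup[OF Kc] by metis
  obtain k where k: "norm (M z0) < k" "k < 1"
    using M(2)[of z0] z0(1) KD dense[of "norm (M z0)" 1] by (metis mem_ball_0 subsetD)
  have k0: "0 < k" using k(1) norm_ge_zero[of "M z0"] by linarith
  have hk: "norm (h z) < k" if "norm z < 1" for z
  proof -
    have "Moebius_function 0 (- q) z \<in> unit_disc"
      using that assms(2) Moebius_function_norm_lt_1[of "- q" z 0] by simp
    then have "g (Moebius_function 0 (- q) z) \<in> K"
      unfolding K_def by (meson closure_subset image_eqI subsetD)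
    then show ?thesis using z0(2) k(1) unfolding h_def o_apply by (meson order_le_less_trans)
  qed
  have contr: "norm (h z) \<le> k * norm z" if "norm z < 1" for z
  proof -
    have "norm (h z / k) \<le> norm z"
      using hk k0 h that by (intro Schwarz_Lemma(1)[of "\<lambda>z. h z / k"])
        (auto intro!: holomorphic_intros simp: norm_divide)
    then show ?thesis using k0 by (simp add: norm_divide field_simps)
  qed
  have gM: "norm (M (g z)) \<le> k * norm (M z)" if "z \<in> unit_disc" for z
    using contr[of "M z"] M(2)[OF that] conjugate_from_origin[OF assms(2) that]
    by (simp add: h_def M_def)
  have it: "(g ^^ n) z \<in> unit_disc \<and> norm (M ((g ^^ n) z)) \<le> k ^ n" if "z \<in> unit_disc" for n z
  proof (induction n)
    case 0 then show ?case using M(2)[OF that] that by auto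
  next
    case (Suc n)
    have "norm (M (g ((g ^^ n) z))) \<le> k * norm (M ((g ^^ n) z))" using gM Suc by blast
    also have "\<dots> \<le> k * k ^ n" using Suc k0 by (intro mult_left_mono) auto
    finally show ?case using Suc self_mapD[OF assms(1)] by simp
  qed
  have "norm (M y) \<le> k ^ n" for n using it[OF u(1)[of n], of n] u(2) by simp
  moreover have "(\<lambda>n. k ^ n) \<longlonglongrightarrow> 0" using k0 k(2) by (intro LIMSEQ_power_zero) auto
  ultimately have "norm (M y) \<le> 0" by (intro LIMSEQ_le_const) auto
  then have "M y = M q" by (simp add: M_def Moebius_function_eq_zero)
  moreover have "y \<in> unit_disc" using it[OF u(1)[of 0], of 0] u(2)[of 0] by simp
  ultimately show "y = q" using Moebius_function_inj assms(2) by (simp add: M_def)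
qed

section \<open>The half-plane picture at a boundary point\<close>

definition cayley :: "complex \<Rightarrow> complex \<Rightarrow> complex" where
  "cayley p z = (p + z) / (p - z)"

definition cayley_inv :: "complex \<Rightarrow> complex \<Rightarrow> complex" where
  "cayley_inv p w = p * (w - 1) / (w + 1)"

lemma cayley_plus_1:
  assumes "z \<noteq> p"
  shows "cayley p z + 1 = 2 * p / (p - z)"
  using assms by (simp add: cayley_def field_simps)

lemma Re_cayley_pos:
  assumes "norm p = 1" "z \<in> unit_disc"
  shows "Re (cayley p z) > 0"
proof -
  have "Re ((p + z) * cnj (p - z)) = (norm p)\<^sup>2 - (norm z)\<^sup>2"
    unfolding cmod_power2 by (simp add: power2_eq_square algebra_simps)
  moreover have "(norm z)\<^sup>2 < 1" using assms by (simp add: power_less_one_iff)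
  ultimately show ?thesis using assms by (simp add: cayley_def Re_complex_div_gt_0)
qed

lemma norm_minus_1_less_norm_plus_1:
  assumes "Re w > 0"
  shows "norm (w - 1) < norm (w + 1)"
  using assms by (simp add: norm_lt_square cmod_def power2_eq_square algebra_simps)

lemma cayley_inv_in_disc:
  assumes "norm p = 1" "Re w > 0"
  shows "cayley_inv p w \<in> unit_disc"
proof -
  have "norm (w + 1) > 0" using norm_minus_1_less_norm_plus_1[OF assms(2)] norm_ge_zero[of "w - 1"] by linarith
  then show ?thesis
    using norm_minus_1_less_norm_plus_1[OF assms(2)] assms(1)
    by (simp add: cayley_inv_def norm_mult norm_divide)
qed

lemma cayley_cayley_inv:
  assumes "norm p = 1" "Re w > 0"
  shows "cayley p (cayley_inv p w) = w"
proof -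
  have "p \<noteq> 0" "w + 1 \<noteq> 0" using assms by (auto simp: add_eq_0_iff2)
  then have "p + cayley_inv p w = 2 * p * w / (w + 1)" "p - cayley_inv p w = 2 * p / (w + 1)"
    by (simp_all add: cayley_inv_def field_simps)
  with \<open>p \<noteq> 0\<close> \<open>w + 1 \<noteq> 0\<close> show ?thesis by (simp add: cayley_def)
qed

lemma cayley_inv_cayley:
  assumes "norm p = 1" "z \<in> unit_disc"
  shows "cayley_inv p (cayley p z) = z"
proof -
  have "p \<noteq> 0" "p - z \<noteq> 0" using assms by auto
  then have "cayley p z - 1 = 2 * z / (p - z)" "cayley p z + 1 = 2 * p / (p - z)"
    by (simp_all add: cayley_def field_simps)
  with \<open>p \<noteq> 0\<close> \<open>p - z \<noteq> 0\<close> show ?thesis by (simp add: cayley_inv_def)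
qed

lemma cayley_inj:
  assumes "norm p = 1" "z \<in> unit_disc" "w \<in> unit_disc" "cayley p z = cayley p w"
  shows "z = w"
  using assms cayley_inv_cayley by metis

lemma minus_cayley_inv:
  assumes "w \<noteq> - 1"
  shows "p - cayley_inv p w = 2 * p / (w + 1)"
proof -
  have "w + 1 \<noteq> 0" using assms by (simp add: add_eq_0_iff2)
  then show ?thesis by (simp add: cayley_inv_def field_simps)
qed

text \<open>
  For \<open>M > 1\<close>, the condition \<open>|w + 1| < M Re w\<close> describes, far out, a sector around the positive
  real axis. With \<open>s = |w + 1|\<close> and \<open>t = |w - 1|\<close>, the image \<open>z\<close> of \<open>w\<close> has \<open>|z| = t / s\<close> and
  \<open>|z - p| = 2 / s\<close>, while \<open>s\<^sup>2 - t\<^sup>2 = 4 Re w\<close>.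
\<close>

lemma cayley_inv_in_stolz_region:
  assumes "norm p = 1" "Re w > 0" "norm (w + 1) < M * Re w"
  shows "cayley_inv p w \<in> stolz_region p M"
proof -
  define s where "s = norm (w + 1)"
  define t where "t = norm (w - 1)"
  have st: "t < s" "0 \<le> t" "0 < s"
    using norm_minus_1_less_norm_plus_1[OF assms(2)] norm_ge_zero[of "w - 1"]
    unfolding s_def t_def by linarith+
  have M: "M > 0" using assms(2,3) st(3) unfolding s_def by (smt (verit) zero_less_mult_iff)
  have sq: "s\<^sup>2 - t\<^sup>2 = 4 * Re w"
    unfolding s_def t_def cmod_power2 by (simp add: power2_eq_square algebra_simps)
  have n: "norm (cayley_inv p w) = t / s"
    using assms(1) by (simp add: cayley_inv_def s_def t_def norm_mult norm_divide)
  have "w \<noteq> - 1" using assms(2) by auto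
  then have d: "norm (cayley_inv p w - p) = 2 / s"
    using minus_cayley_inv[of w p] assms(1)
    by (metis s_def norm_minus_commute norm_divide norm_mult norm_numeral mult.right_neutral)
  have "4 * Re w = (s - t) * (s + t)" using sq by (simp add: power2_eq_square algebra_simps)
  also have "\<dots> \<le> (s - t) * (2 * s)" using st by (intro mult_left_mono) auto
  finally have "2 * Re w \<le> (s - t) * s" by (simp add: mult.commute)
  then have "M * (2 * Re w) \<le> M * ((s - t) * s)" using M by (intro mult_left_mono) auto
  then have "2 * s < (M * (s - t)) * s" using assms(3) by (simp add: s_def algebra_simps)
  then have "2 < M * (s - t)" using st(3) by simp
  then have "2 / s < M * (1 - t / s)" using st(3) by (simp add: field_simps)
  then show ?thesis
    using cayley_inv_in_disc[OF assms(1,2)] by (simp add: stolz_region_def n d)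
qed

text \<open>
  Sequences with \<open>w n / n \<longlonglongrightarrow> e\<close> and \<open>Re e > 0\<close> go to infinity inside a sector of the half-plane, so
  they are convenient test sequences for angular limits: they include the multiples of a fixed
  direction, the orbits of a translation by \<open>b\<close> with \<open>Re b > 0\<close>, and the images of such
  sequences under half-plane maps \<open>w \<mapsto> A w + B\<close> with \<open>A > 0\<close>.
\<close>

lemma affine_linear_growth: "(\<lambda>n. (a + of_nat n * b) / of_nat n) \<longlonglongrightarrow> b" for a b :: complex
proof -
  have "(\<lambda>n. a * (1 / of_nat n) + b) \<longlonglongrightarrow> a * 0 + b" by (intro tendsto_intros)
  then have "(\<lambda>n. a * (1 / of_nat n) + b) \<longlonglongrightarrow> b" by simp
  then show ?thesis
    by (rule Lim_transform_eventually)
      (use eventually_gt_at_top[of 0] in eventually_elim, simp add: add_divide_distrib)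
qed

lemma linear_growth_at_infinity:
  fixes w :: "nat \<Rightarrow> complex"
  assumes "(\<lambda>n. w n / of_nat n) \<longlonglongrightarrow> e" "e \<noteq> 0"
  shows "filterlim w at_infinity sequentially"
proof -
  have "filterlim (\<lambda>n. w n / of_nat n * of_nat n) at_infinity sequentially"
    using assms by (intro tendsto_mult_filterlim_at_infinity[OF assms(1)] tendsto_of_nat) auto
  then show ?thesis
    by (rule filterlim_mono_eventually[OF _ order_refl order_refl])
      (use eventually_gt_at_top[of 0] in eventually_elim, auto)
qed

lemma eventually_Re_pos_linear_growth:
  fixes w :: "nat \<Rightarrow> complex"
  assumes "(\<lambda>n. w n / of_nat n) \<longlonglongrightarrow> e" "Re e > 0"
  shows "eventually (\<lambda>n. Re (w n) > 0) sequentially"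
proof -
  have "eventually (\<lambda>n. 0 < Re (w n / of_nat n)) sequentially"
    using order_tendstoD(1)[OF tendsto_Re[OF assms(1)] assms(2)] .
  with eventually_gt_at_top[of 0] show ?thesis
    by eventually_elim (simp add: Re_divide_of_nat zero_less_divide_iff)
qed

lemma tendsto_cayley_inv_at_infinity:
  assumes "filterlim w at_infinity F"
  shows "((\<lambda>n. cayley_inv p (w n)) \<longlongrightarrow> p) F"
proof -
  have "filterlim (\<lambda>n. w n + 1) at_infinity F"
    using assms by (intro tendsto_add_filterlim_at_infinity') auto
  then have "((\<lambda>n. p - 2 * p / (w n + 1)) \<longlongrightarrow> p - 0) F"
    by (intro tendsto_intros tendsto_divide_0[OF tendsto_const])
  moreover have "eventually (\<lambda>n. p - 2 * p / (w n + 1) = cayley_inv p (w n)) F"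
    using filterlim_at_infinity_imp_eventually_ne[OF assms, of "- 1"]
    by eventually_elim (metis minus_cayley_inv diff_diff_eq2 add_diff_cancel_left' diff_add_cancel)
  ultimately show ?thesis by (simp add: tendsto_cong)
qed

lemma angular_tendsto_sequentially:
  fixes w :: "nat \<Rightarrow> complex"
  assumes "angular_tendsto g l p" "norm p = 1"
    and w: "(\<lambda>n. w n / of_nat n) \<longlonglongrightarrow> e" "Re e > 0"
  shows "(\<lambda>n. g (cayley_inv p (w n))) \<longlonglongrightarrow> l"
proof -
  \<comment> \<open>Any aperture larger than \<open>|e| / Re e\<close> works; the summand 2 also keeps it above 1.\<close>
  define M where "M = norm e / Re e + 2"
  have "norm e / Re e \<ge> 0" using w(2) by simp
  then have M: "M > 1" unfolding M_def by linarith
  have inf: "filterlim w at_infinity sequentially"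
    by (rule linear_growth_at_infinity[OF w(1)]) (use w(2) in auto)
  have shift: "(\<lambda>n. w n / of_nat n + 1 / of_nat n) \<longlonglongrightarrow> e"
    using tendsto_add[OF w(1) lim_1_over_n] by simp
  have 1: "(\<lambda>n. M * Re (w n / of_nat n) - norm (w n / of_nat n + 1 / of_nat n))
      \<longlonglongrightarrow> M * Re e - norm e"
    by (intro tendsto_intros w(1) shift)
  have "M * Re e - norm e > 0" using w(2) by (simp add: M_def field_simps)
  then have "eventually (\<lambda>n. 0 < M * Re (w n / of_nat n) - norm (w n / of_nat n + 1 / of_nat n)) sequentially"
    using order_tendstoD(1)[OF 1] by blast
  moreover have "eventually (\<lambda>n. n > 0) sequentially" by (rule eventually_gt_at_top)
  ultimately have "eventually (\<lambda>n. norm (w n + 1) < M * Re (w n)) sequentially"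
  proof eventually_elim
    case (elim n)
    have "norm (w n / of_nat n + 1 / of_nat n) = norm (w n + 1) / real n"
      using elim by (simp add: add_divide_distrib[symmetric] norm_divide)
    then show ?case using elim by (simp add: Re_divide_of_nat field_simps)
  qed
  with eventually_Re_pos_linear_growth[OF w]
  have ev: "eventually (\<lambda>n. cayley_inv p (w n) \<in> stolz_region p M) sequentially"
    by eventually_elim (rule cayley_inv_in_stolz_region[OF assms(2)])
  then have "eventually (\<lambda>n. cayley_inv p (w n) \<in> stolz_region p M \<and> cayley_inv p (w n) \<noteq> p) sequentially"
    by eventually_elim (use assms(2) in \<open>auto simp: stolz_region_def\<close>)
  then have "filterlim (\<lambda>n. cayley_inv p (w n)) (at p within stolz_region p M) sequentially"
    using tendsto_cayley_inv_at_infinity[OF inf, of p] by (simp add: filterlim_at)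
  moreover have "(g \<longlongrightarrow> l) (at p within stolz_region p M)"
    using assms(1) M by (simp add: angular_tendsto_def)
  ultimately show ?thesis by (rule filterlim_compose[rotated])
qed

lemma angular_tendsto_unique:
  assumes "angular_tendsto g l p" "angular_tendsto g l' p" "norm p = 1"
  shows "l = l'"
proof -
  from angular_tendsto_sequentially[OF assms(1,3) affine_linear_growth[of 0 1]]
    angular_tendsto_sequentially[OF assms(2,3) affine_linear_growth[of 0 1]]
  show ?thesis by (auto intro: LIMSEQ_unique)
qed

text \<open>
  The half-plane normal form and the positivity of the slope of \<open>f\<close> at infinity come from this
  description of the affine maps of the half-plane. Degenerate coefficients are included because
  limits only preserve the weak inequality.
\<close>

lemma affine_half_plane_coefficients:
  assumes "\<And>w. Re w > 0 \<Longrightarrow> Re (a * w + b) \<ge> 0"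
  shows "Im a = 0" "Re a \<ge> 0" "Re b \<ge> 0"
proof -
  show Im: "Im a = 0"
  proof (rule ccontr)
    assume "Im a \<noteq> 0"
    then show False
      using assms[of "Complex 1 ((Re a + Re b + 1) / Im a)"] by simp
  qed
  show Re: "Re a \<ge> 0"
  proof (rule ccontr)
    assume neg: "\<not> Re a \<ge> 0"
    define x where "x = (\<bar>Re b\<bar> + 1) / (- Re a)"
    have "x > 0" "Re a * x = - \<bar>Re b\<bar> - 1" using neg by (auto simp: x_def field_simps)
    then show False using assms[of "of_real x"] Im by simp
  qed
  show "Re b \<ge> 0"
  proof (rule ccontr)
    assume neg: "\<not> Re b \<ge> 0"
    define x where "x = - Re b / (2 * (Re a + 1))"
    have x: "x > 0" "(Re a + 1) * x = - Re b / 2" using neg Re by (auto simp: x_def field_simps)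
    then have "Re a * x \<le> - Re b / 2" by (simp add: algebra_simps)
    then show False using assms[of "of_real x"] x(1) Im neg by simp
  qed
qed

section \<open>Linear fractional maps near a fixed point\<close>

text \<open>
  The fixed point may lie on the circle, where the map has no prescribed value, so being fixed is
  expressed by a sequence \<open>z\<close>. The denominator cannot vanish at \<open>q\<close>: the numerator would vanish there
  too, and the determinant would be zero. Recentring at \<open>q\<close> then leaves the multiplier \<open>\<mu>\<close> and one
  further parameter \<open>\<kappa>\<close>.
\<close>

lemma linear_fractional_fixed_point_form:
  assumes "linear_fractional_self_map g"
    and z: "eventually (\<lambda>n. z n \<in> unit_disc) sequentially" "z \<longlonglongrightarrow> q" "(\<lambda>n. g (z n)) \<longlonglongrightarrow> q"
  obtains \<mu> \<kappa> where "\<mu> \<noteq> 0"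
    "\<And>z. z \<in> unit_disc \<Longrightarrow> 1 + \<kappa> * (z - q) \<noteq> 0 \<and> g z - q = \<mu> * (z - q) / (1 + \<kappa> * (z - q))"
proof -
  obtain a b c d where det: "a * d - b * c \<noteq> 0"
    and g: "\<And>z. z \<in> unit_disc \<Longrightarrow> c * z + d \<noteq> 0 \<and> g z = (a * z + b) / (c * z + d)"
    using assms(1) unfolding linear_fractional_self_map_def by blast
  \<comment> \<open>The denominator at \<open>q\<close>.\<close>
  define e where "e = c * q + d"
  have "(\<lambda>n. g (z n) * (c * z n + d)) \<longlonglongrightarrow> q * e"
    unfolding e_def by (intro tendsto_intros z)
  moreover have "eventually (\<lambda>n. g (z n) * (c * z n + d) = a * z n + b) sequentially"
    using z(1) by eventually_elim (use g in simp)
  ultimately have "(\<lambda>n. a * z n + b) \<longlonglongrightarrow> q * e"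
    by (simp add: tendsto_cong)
  moreover have "(\<lambda>n. a * z n + b) \<longlonglongrightarrow> a * q + b" by (intro tendsto_intros z)
  ultimately have fixed: "a * q + b = q * e" using LIMSEQ_unique by blast
  have b: "b = q * e - a * q" using fixed by (simp add: algebra_simps)
  have d: "d = e - c * q" by (simp add: e_def)
  have det': "a * d - b * c = e * (a - q * c)" unfolding b d by (simp add: algebra_simps)
  have e: "e \<noteq> 0" and K: "a - q * c \<noteq> 0" using det unfolding det' by auto
  show ?thesis
  proof (rule that[of "(a - q * c) / e" "c / e"])
    show "(a - q * c) / e \<noteq> 0" using e K by simp
    fix z assume z: "z \<in> unit_disc"
    have den: "1 + c / e * (z - q) = (c * z + d) / e" using e by (simp add: d field_simps)
    have "g z - q = (a * z + b - q * (c * z + d)) / (c * z + d)"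
      using g[OF z] by (simp add: diff_divide_distrib)
    also have "a * z + b - q * (c * z + d) = (a - q * c) * (z - q)"
      unfolding b d by (simp add: algebra_simps)
    finally show "1 + c / e * (z - q) \<noteq> 0 \<and> g z - q = (a - q * c) / e * (z - q) / (1 + c / e * (z - q))"
      unfolding den using e g[OF z] by simp
  qed
qed

lemma multiplier_at_interior_fixed_point:
  assumes "q \<in> unit_disc"
    and g: "\<And>z. z \<in> unit_disc \<Longrightarrow> g z - q = \<mu> * (z - q) / (1 + \<kappa> * (z - q))"
  shows "g q = q" "deriv g q = \<mu>"
proof -
  show "g q = q" using g[OF assms(1)] by simp
  have "((\<lambda>z. q + \<mu> * (z - q) / (1 + \<kappa> * (z - q))) has_field_derivative \<mu>) (at q)"
    by (auto intro!: derivative_eq_intros)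
  then have "(g has_field_derivative \<mu>) (at q)"
    by (rule has_field_derivative_transform_within_open[of _ _ _ unit_disc])
      (use assms(1) g in \<open>auto simp: algebra_simps\<close>)
  then show "deriv g q = \<mu>" by (rule DERIV_imp_deriv)
qed

definition half_plane_model :: "(complex \<Rightarrow> complex) \<Rightarrow> complex \<Rightarrow> real \<Rightarrow> complex \<Rightarrow> bool" where
  "half_plane_model g p A B \<longleftrightarrow> self_map g \<and> norm p = 1 \<and> A > 0 \<and> Re B \<ge> 0 \<and>
     (\<forall>z\<in>unit_disc. cayley p (g z) = of_real A * cayley p z + B)"

text \<open>
  Fixing \<open>p\<close> means fixing infinity in the half-plane, and a linear fractional map that fixes
  infinity is affine. Its coefficients \<open>a\<close> and \<open>b\<close> are read off from
  \<open>cayley p z + 1 = 2 p / (p - z)\<close>; the half-plane being preserved makes \<open>a\<close> real and positive.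
\<close>

lemma half_plane_model_exists:
  assumes "self_map g" "norm p = 1" "\<mu> \<noteq> 0"
    and g: "\<And>z. z \<in> unit_disc \<Longrightarrow>
      1 + \<kappa> * (z - p) \<noteq> 0 \<and> g z - p = \<mu> * (z - p) / (1 + \<kappa> * (z - p))"
  obtains A B where "half_plane_model g p A B" "\<mu> = 1 / of_real A"
proof -
  define a where "a = 1 / \<mu>"
  define b where "b = (1 - 2 * p * \<kappa>) / \<mu> - 1"
  have ab: "cayley p (g z) = a * cayley p z + b" if "z \<in> unit_disc" for z
  proof -
    have "z \<noteq> p" "g z \<noteq> p" using self_mapD[OF assms(1) that] that assms(2) by auto
    have "cayley p (g z) + 1 = 2 * p / - (g z - p)" using cayley_plus_1[OF \<open>g z \<noteq> p\<close>] by simp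
    also have "\<dots> = (1 + \<kappa> * (z - p)) / \<mu> * (2 * p / (p - z))"
    proof -
      have "2 * p / - (\<mu> * t / x) = x / \<mu> * (2 * p / - t)" if "t \<noteq> 0" "x \<noteq> 0" for t x
        using that assms(3) by (simp add: field_simps)
      from this[of "z - p" "1 + \<kappa> * (z - p)"] show ?thesis
        using g[OF \<open>z \<in> unit_disc\<close>] \<open>z \<noteq> p\<close> by simp
    qed
    also have "\<dots> = 1 / \<mu> * (2 * p / (p - z)) - 2 * p * \<kappa> / \<mu>"
      using assms(3) \<open>z \<noteq> p\<close> by (simp add: divide_simps) (simp add: algebra_simps)
    also have "2 * p / (p - z) = cayley p z + 1" using cayley_plus_1[OF \<open>z \<noteq> p\<close>] by simp
    finally show ?thesis by (simp add: a_def b_def diff_divide_distrib algebra_simps)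
  qed
  have "Re (a * w + b) \<ge> 0" if "Re w > 0" for w
    using ab[OF cayley_inv_in_disc[OF assms(2) that]] cayley_cayley_inv[OF assms(2) that]
      Re_cayley_pos[OF assms(2) self_mapD[OF assms(1) cayley_inv_in_disc[OF assms(2) that]]]
    by (simp add: less_imp_le)
  note co = affine_half_plane_coefficients[OF this]
  have a: "a = of_real (Re a)" using co(1) by (simp add: complex_eq_iff)
  have "a \<noteq> 0" using assms(3) by (simp add: a_def)
  then have "Re a > 0" using co(2) a by (metis less_eq_real_def of_real_0)
  then have "half_plane_model g p (Re a) b"
    using assms(1,2) co(3) ab a unfolding half_plane_model_def by metis
  moreover have "\<mu> = 1 / of_real (Re a)" unfolding a[symmetric] by (simp add: a_def)
  ultimately show ?thesis by (rule that)
qed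

text \<open>
  The model extends smoothly to \<open>p\<close>, because \<open>(z - p) / (g z - p)\<close> is the polynomial \<open>k\<close> in \<open>z\<close>. Thus
  the limits exist from within the whole disc, and a fortiori in Stolz regions.
\<close>

lemma half_plane_model_angular_derivative:
  assumes m: "half_plane_model g p A B" and S: "S \<subseteq> unit_disc"
  shows "((\<lambda>z. (g z - p) / (z - p)) \<longlongrightarrow> 1 / of_real A) (at p within S)"
    and "(g \<longlongrightarrow> p) (at p within S)"
proof -
  have p: "norm p = 1" "p \<noteq> 0" and A: "A > 0" using m by (auto simp: half_plane_model_def)
  define k where "k z = of_real A + (B + 1 - of_real A) * (p - z) / (2 * p)" for z
  have k: "k z * (g z - p) = z - p" if z: "z \<in> unit_disc" for z
  proof -
    have gz: "g z \<in> unit_disc" using m z self_mapD by (auto simp: half_plane_model_def)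
    then have np: "z \<noteq> p" "g z \<noteq> p" using z p by auto
    have "2 * p / (p - g z) = of_real A * (2 * p / (p - z)) + (B + 1 - of_real A)"
      using m z unfolding cayley_plus_1[OF np(1), symmetric] cayley_plus_1[OF np(2), symmetric]
      by (simp add: half_plane_model_def algebra_simps)
    then have "2 * p * (p - z) = (of_real A * (2 * p) + (B + 1 - of_real A) * (p - z)) * (p - g z)"
      using np by (simp add: divide_simps) 
    also have "\<dots> = 2 * p * (k z * (p - g z))"
      using p(2) by (simp add: k_def field_simps)
    finally have "p - z = k z * (p - g z)" using p(2) by simp
    then show ?thesis by (simp add: algebra_simps)
  qed
  have quot: "g z - p = (z - p) / k z" if "z \<in> unit_disc" "k z \<noteq> 0" for z
    using k[OF that(1)] that(2) by (metis nonzero_mult_div_cancel_left)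
  have kl: "(k \<longlongrightarrow> of_real A) (at p within S)"
    unfolding k_def by (auto intro!: tendsto_eq_intros simp: p)
  have ev: "eventually (\<lambda>z. z \<in> unit_disc \<and> z \<noteq> p \<and> k z \<noteq> 0) (at p within S)"
  proof -
    have "eventually (\<lambda>z. k z \<noteq> 0) (at p within S)"
      using tendsto_imp_eventually_ne[OF kl, of 0] A by simp
    moreover have "eventually (\<lambda>z. z \<in> S \<and> z \<noteq> p) (at p within S)"
      by (simp add: eventually_at_filter)
    ultimately show ?thesis by eventually_elim (use S in auto)
  qed
  have "((\<lambda>z. 1 / k z) \<longlongrightarrow> 1 / of_real A) (at p within S)"
    using kl A by (intro tendsto_intros) auto
  moreover have "eventually (\<lambda>z. 1 / k z = (g z - p) / (z - p)) (at p within S)"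
    using ev by eventually_elim (simp add: quot)
  ultimately show "((\<lambda>z. (g z - p) / (z - p)) \<longlongrightarrow> 1 / of_real A) (at p within S)"
    by (rule Lim_transform_eventually)
  have "((\<lambda>z. p + (z - p) / k z) \<longlongrightarrow> p + (p - p) / of_real A) (at p within S)"
    using kl A by (intro tendsto_intros) auto
  moreover have "eventually (\<lambda>z. p + (z - p) / k z = g z) (at p within S)"
    using ev by eventually_elim (simp add: quot[symmetric])
  ultimately have "(g \<longlongrightarrow> p + (p - p) / of_real A) (at p within S)"
    by (rule Lim_transform_eventually)
  then show "(g \<longlongrightarrow> p) (at p within S)" by simp
qed

lemma half_plane_model_has_angular_derivative_iff:
  assumes m: "half_plane_model g p A B"
  shows "has_angular_derivative g D p \<longleftrightarrow> D = 1 / of_real A"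
proof -
  have p: "norm p = 1" using m by (simp add: half_plane_model_def)
  have S: "stolz_region p M \<subseteq> unit_disc" for M by (auto simp: stolz_region_def)
  have 1: "angular_tendsto g p p" "angular_tendsto (\<lambda>z. (g z - p) / (z - p)) (1 / of_real A) p"
    using half_plane_model_angular_derivative[OF m S] by (auto simp: angular_tendsto_def)
  show ?thesis
  proof
    assume "has_angular_derivative g D p"
    then obtain q where "angular_tendsto g q p" "angular_tendsto (\<lambda>z. (g z - q) / (z - p)) D p"
      unfolding has_angular_derivative_def by blast
    then show "D = 1 / of_real A" using 1 angular_tendsto_unique p by metis
  next
    assume "D = 1 / of_real A"
    then show "has_angular_derivative g D p"
      using 1 p unfolding has_angular_derivative_def by (intro bexI[of _ p]) auto
  qed
qed

text \<open>
  The image of \<open>w \<mapsto> A w + B\<close> is the half-plane \<open>Re w > Re B\<close>; if \<open>Re B > 0\<close>, the point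
  \<open>B / 2\<close> is missed.
\<close>

lemma half_plane_model_automorphism_iff:
  assumes m: "half_plane_model g p A B"
  shows "disc_automorphism g \<longleftrightarrow> Re B = 0"
proof -
  have p: "norm p = 1" and A: "A > 0" and B: "Re B \<ge> 0" and g: "self_map g"
    and gz: "\<And>z. z \<in> unit_disc \<Longrightarrow> cayley p (g z) = of_real A * cayley p z + B"
    using m by (auto simp: half_plane_model_def)
  show ?thesis
  proof
    assume "disc_automorphism g"
    then have surj: "g ` unit_disc = unit_disc" by (simp add: disc_automorphism_def bij_betw_def)
    show "Re B = 0"
    proof (rule ccontr)
      assume "Re B \<noteq> 0"
      then have B': "Re (B / 2) > 0" using B by simp
      obtain z where z: "z \<in> unit_disc" "g z = cayley_inv p (B / 2)"
        using cayley_inv_in_disc[OF p B'] surj by (metis imageE)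
      have "of_real A * cayley p z + B = B / 2"
        using gz[OF z(1)] cayley_cayley_inv[OF p B'] z(2) by simp
      then have "Re (of_real A * cayley p z + B) = Re (B / 2)" by (rule arg_cong)
      then have "A * Re (cayley p z) = - Re B / 2" by simp
      moreover have "A * Re (cayley p z) > 0" using A Re_cayley_pos[OF p z(1)] by simp
      ultimately show False using B by simp
    qed
  next
    assume B0: "Re B = 0"
    have "inj_on g unit_disc"
    proof (rule inj_onI)
      fix z w assume zw: "z \<in> unit_disc" "w \<in> unit_disc" "g z = g w"
      then have "of_real A * cayley p z = of_real A * cayley p w"
        using gz[OF zw(1)] gz[OF zw(2)] by (metis add_right_cancel)
      then show "z = w" using A cayley_inj[OF p zw(1,2)] by auto
    qed
    moreover have "unit_disc \<subseteq> g ` unit_disc"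
    proof
      fix y assume y: "y \<in> unit_disc"
      define w where "w = (cayley p y - B) / of_real A"
      have w: "Re w > 0" using Re_cayley_pos[OF p y] B0 A by (simp add: w_def)
      note z = cayley_inv_in_disc[OF p w]
      have "cayley p (g (cayley_inv p w)) = cayley p y"
        unfolding gz[OF z] cayley_cayley_inv[OF p w] using A by (simp add: w_def)
      then have "g (cayley_inv p w) = y" using cayley_inj[OF p self_mapD[OF g z] y] by simp
      then show "y \<in> g ` unit_disc" using z by blast
    qed
    moreover have "g ` unit_disc \<subseteq> unit_disc" using g by (simp add: self_map_def)
    ultimately show "disc_automorphism g"
      using g by (auto simp: disc_automorphism_def bij_betw_def)
  qed
qed

lemma self_map_iterate: "self_map g \<Longrightarrow> z \<in> unit_disc \<Longrightarrow> (g ^^ n) z \<in> unit_disc"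
  by (induction n) (use self_mapD in auto)

text \<open>
  Iterates move a point in the fixed direction of its first displacement \<open>(A - 1) w + B\<close>, and do so
  at least \<open>n\<close> times; the factor is \<open>s = 1 + A + \<dots> + A ^ (n - 1)\<close>. This form covers the
  hyperbolic and the parabolic case together.
\<close>

lemma half_plane_model_iterate:
  assumes m: "half_plane_model g p A B" and A: "A \<ge> 1"
  obtains s where "s \<ge> real n"
    "\<And>z. z \<in> unit_disc \<Longrightarrow>
       cayley p ((g ^^ n) z) = cayley p z + of_real s * ((of_real A - 1) * cayley p z + B)"
proof -
  have "\<exists>s \<ge> real n. \<forall>z\<in>unit_disc.
    cayley p ((g ^^ n) z) = cayley p z + of_real s * ((of_real A - 1) * cayley p z + B)"
  proof (induction n)
    case 0 show ?case by (intro exI[of _ 0]) simp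
  next
    case (Suc n)
    then obtain s where s: "s \<ge> real n" "\<forall>z\<in>unit_disc.
      cayley p ((g ^^ n) z) = cayley p z + of_real s * ((of_real A - 1) * cayley p z + B)" by blast
    have "real (Suc n) \<le> 1 + A * s" using s(1) A mult_mono[of 1 A s s] by simp
    moreover have "cayley p ((g ^^ Suc n) z)
        = cayley p z + of_real (1 + A * s) * ((of_real A - 1) * cayley p z + B)"
      if z: "z \<in> unit_disc" for z
    proof -
      have "(g ^^ n) z \<in> unit_disc" using m z self_map_iterate by (auto simp: half_plane_model_def)
      then have "cayley p ((g ^^ Suc n) z) = of_real A * cayley p ((g ^^ n) z) + B"
        using m by (simp add: half_plane_model_def)
      also have "cayley p ((g ^^ n) z) = cayley p z + of_real s * ((of_real A - 1) * cayley p z + B)"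
        using s(2) z by blast
      finally show ?thesis by (simp add: algebra_simps)
    qed
    ultimately show ?case by blast
  qed
  then show ?thesis using that by blast
qed

lemma half_plane_model_displacement:
  assumes m: "half_plane_model g p A B" and A: "A \<ge> 1" and "non_identity g" "z \<in> unit_disc"
  shows "(of_real A - 1) * cayley p z + B \<noteq> 0"
proof (cases "A = 1")
  case True
  have "B \<noteq> 0"
  proof
    assume "B = 0"
    then have "cayley p (g z) = cayley p z" if "z \<in> unit_disc" for z
      using m that True by (simp add: half_plane_model_def)
    then have "g z = z" if "z \<in> unit_disc" for z
      using m that cayley_inj self_mapD unfolding half_plane_model_def by metis
    then show False using assms(3) by (simp add: non_identity_def)
  qed
  then show ?thesis using True by simp
next
  case False
  have "Re ((of_real A - 1) * cayley p z + B) = (A - 1) * Re (cayley p z) + Re B" by simp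
  also have "\<dots> > 0"
    using m assms(4) A False Re_cayley_pos[of p z] by (auto simp: half_plane_model_def intro!: add_pos_nonneg)
  finally show ?thesis by (metis less_irrefl zero_complex.sel(1))
qed

text \<open>
  The displacement does not vanish, so there is no fixed point in the disc; on a compact set
  its modulus is bounded below by some \<open>1 / E\<close>, so the orbits escape to infinity at a uniform linear
  rate. Distances to \<open>p\<close> are \<open>2 / |w + 1|\<close> in half-plane coordinates.
\<close>

lemma half_plane_model_denjoy_wolff_point:
  assumes m: "half_plane_model g p A B" and A: "A \<ge> 1" and ni: "non_identity g"
  shows "\<not> elliptic g" "denjoy_wolff_point g p"
proof -
  have p: "norm p = 1" and g: "self_map g"
    and gz: "\<And>z. z \<in> unit_disc \<Longrightarrow> cayley p (g z) = of_real A * cayley p z + B"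
    using m by (auto simp: half_plane_model_def)
  define \<Delta> where "\<Delta> z = (of_real A - 1) * cayley p z + B" for z
  have \<Delta>0: "\<Delta> z \<noteq> 0" if "z \<in> unit_disc" for z
    unfolding \<Delta>_def by (rule half_plane_model_displacement[OF m A ni that])
  have nofix: "g z \<noteq> z" if "z \<in> unit_disc" for z
    using gz[OF that] \<Delta>0[OF that] by (auto simp: \<Delta>_def algebra_simps)
  then show "\<not> elliptic g" by (auto simp: elliptic_def)
  have "uniform_limit K (\<lambda>n. g ^^ n) (\<lambda>_. p) sequentially"
    if K: "compact K" "K \<subseteq> unit_disc" for K
  proof -
    have cc: "continuous_on K (cayley p)"
      unfolding cayley_def using K(2) p by (auto intro!: continuous_intros)
    have "bounded ((\<lambda>z. cayley p z + 1) ` K)"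
      using cc K(1) by (intro compact_imp_bounded compact_continuous_image continuous_intros)
    then obtain C where C: "\<And>z. z \<in> K \<Longrightarrow> norm (cayley p z + 1) \<le> C"
      unfolding bounded_iff by auto
    have "bounded ((\<lambda>z. 1 / \<Delta> z) ` K)"
      unfolding \<Delta>_def using cc K \<Delta>0
      by (intro compact_imp_bounded compact_continuous_image continuous_intros) (auto simp: \<Delta>_def)
    then obtain E where E: "E > 0" "\<And>z. z \<in> K \<Longrightarrow> norm (1 / \<Delta> z) \<le> E"
      unfolding bounded_pos by auto
    have \<Delta>E: "norm (\<Delta> z) \<ge> 1 / E" if "z \<in> K" for z
      using E(2)[OF that] E(1) \<Delta>0 that K(2) by (auto simp: norm_divide field_simps subset_iff)
    show ?thesis
    proof (rule uniform_limitI)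
      fix \<epsilon> :: real assume \<epsilon>: "\<epsilon> > 0"
      obtain N where N: "real N > (2 / \<epsilon> + C) * E" using reals_Archimedean2 by blast
      have "dist ((g ^^ n) z) p < \<epsilon>" if n: "n \<ge> N" and z: "z \<in> K" for n z
      proof -
        have zD: "z \<in> unit_disc" using z K(2) by blast
        obtain s where s: "s \<ge> real n" "cayley p ((g ^^ n) z) = cayley p z + of_real s * \<Delta> z"
          using half_plane_model_iterate[OF m A, of n] zD unfolding \<Delta>_def by metis
        have "(2 / \<epsilon> + C) * E < s" using N n s(1) by linarith
        then have "2 / \<epsilon> + C < s * (1 / E)" using E(1) by (simp add: field_simps)
        also have "\<dots> \<le> s * norm (\<Delta> z)" using s(1) \<Delta>E[OF z] by (intro mult_left_mono) auto
        also have "\<dots> = norm (of_real s * \<Delta> z)" using s(1) by (simp add: norm_mult)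
        also have "\<dots> = norm ((cayley p ((g ^^ n) z) + 1) - (cayley p z + 1))" by (simp add: s(2))
        also have "\<dots> \<le> norm (cayley p ((g ^^ n) z) + 1) + C"
          using C[OF z] norm_triangle_ineq4[of "cayley p ((g ^^ n) z) + 1" "cayley p z + 1"] by linarith
        finally have far: "2 / \<epsilon> < norm (cayley p ((g ^^ n) z) + 1)" by simp
        have "(g ^^ n) z \<noteq> p" using self_map_iterate[OF g zD, of n] p by auto
        then have "norm (cayley p ((g ^^ n) z) + 1) = 2 / dist ((g ^^ n) z) p"
          "dist ((g ^^ n) z) p > 0"
          using cayley_plus_1[of "(g ^^ n) z" p] p by (auto simp: norm_divide norm_mult dist_norm norm_minus_commute)
        then show ?thesis using far \<epsilon> by (simp add: field_simps)
      qed
      then show "\<forall>\<^sub>F n in sequentially. \<forall>z\<in>K. dist ((g ^^ n) z) p < \<epsilon>"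
        unfolding eventually_sequentially by blast
    qed
  qed
  then show "denjoy_wolff_point g p"
    using g ni nofix p by (auto simp: denjoy_wolff_point_def)
qed

lemma denjoy_wolff_point_orbit:
  assumes "denjoy_wolff_point g p" "\<not> elliptic g" "z \<in> unit_disc"
  shows "norm p = 1" "(\<lambda>n. (g ^^ n) z) \<longlonglongrightarrow> p"
proof -
  have *: "norm p = 1" "\<forall>K. compact K \<and> K \<subseteq> unit_disc \<longrightarrow> uniform_limit K (\<lambda>n. g ^^ n) (\<lambda>_. p) sequentially"
    using assms(1,2) by (auto simp: denjoy_wolff_point_def elliptic_def split: if_splits)
  then show "norm p = 1" by simp
  have "uniform_limit {z} (\<lambda>n. g ^^ n) (\<lambda>_. p) sequentially"
    using *(2) assms(3) finite_imp_compact[of "{z}"] by blast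
  then show "(\<lambda>n. (g ^^ n) z) \<longlonglongrightarrow> p" by (rule tendsto_uniform_limitI) simp
qed

lemma half_plane_model_hyperbolic_parabolic_iff:
  assumes m: "half_plane_model g p A B" and A: "A \<ge> 1" and ni: "non_identity g"
  shows "hyperbolic g \<longleftrightarrow> A > 1" "parabolic g \<longleftrightarrow> A = 1"
proof -
  note dw = half_plane_model_denjoy_wolff_point[OF m A ni]
  have uniq: "p' = p" if "denjoy_wolff_point g p'" for p'
    using denjoy_wolff_point_orbit(2)[OF that dw(1), of 0] denjoy_wolff_point_orbit(2)[OF dw(2,1), of 0]
    by (auto intro: LIMSEQ_unique)
  have der: "has_angular_derivative g D p \<longleftrightarrow> D = of_real (1 / A)" for D
    using half_plane_model_has_angular_derivative_iff[OF m] by simp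
  have g: "self_map g" using m by (simp add: half_plane_model_def)
  have "hyperbolic g \<longleftrightarrow> (\<exists>r. has_angular_derivative g (of_real r) p \<and> r < 1)"
    using uniq dw g ni unfolding hyperbolic_def by blast
  also have "\<dots> \<longleftrightarrow> 1 / A < 1" unfolding der of_real_eq_iff by blast
  also have "\<dots> \<longleftrightarrow> A > 1" using A by (simp add: field_simps)
  finally show "hyperbolic g \<longleftrightarrow> A > 1" .
  have "parabolic g \<longleftrightarrow> has_angular_derivative g 1 p"
    using uniq dw g ni unfolding parabolic_def by blast
  also have "\<dots> \<longleftrightarrow> 1 / A = 1" unfolding der by (metis of_real_1 of_real_eq_iff)
  also have "\<dots> \<longleftrightarrow> A = 1" using A by (simp add: field_simps)
  finally show "parabolic g \<longleftrightarrow> A = 1" .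
qed

text \<open>
  For \<open>A < 1\<close> the affine map contracts, so the orbit of a point stays bounded in the half-plane and
  cannot converge to \<open>p\<close>.
\<close>

lemma half_plane_model_at_denjoy_wolff_point:
  assumes lf: "linear_fractional_self_map g" and ne: "\<not> elliptic g" and dw: "denjoy_wolff_point g p"
  obtains A B where "half_plane_model g p A B" "A \<ge> 1"
proof -
  have g: "self_map g" using lf by (simp add: linear_fractional_self_map_def)
  note orb = denjoy_wolff_point_orbit[OF dw ne, of 0]
  have p: "norm p = 1" and lim: "(\<lambda>n. (g ^^ n) 0) \<longlonglongrightarrow> p" using orb by auto
  have orbD: "(g ^^ n) 0 \<in> unit_disc" for n using self_map_iterate[OF g] by simp
  have "(\<lambda>n. g ((g ^^ n) 0)) \<longlonglongrightarrow> p" using LIMSEQ_Suc[OF lim] by simp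
  then obtain \<mu> \<kappa> where "\<mu> \<noteq> 0" "\<And>z. z \<in> unit_disc \<Longrightarrow>
      1 + \<kappa> * (z - p) \<noteq> 0 \<and> g z - p = \<mu> * (z - p) / (1 + \<kappa> * (z - p))"
    using linear_fractional_fixed_point_form[OF lf _ lim] orbD by (metis eventually_sequentially)
  then obtain A B where m: "half_plane_model g p A B"
    using half_plane_model_exists[OF g p] by metis
  have "A \<ge> 1"
  proof (rule ccontr)
    assume A: "\<not> A \<ge> 1"
    \<comment> \<open>The point 0 of the disc corresponds to 1; \<open>C\<close> bounds its orbit since \<open>A * C + norm B \<le> C\<close>.\<close>
    define C where "C = 1 + norm B / (1 - A)"
    have "(1 - A) * C = 1 - A + norm B" using A by (simp add: C_def field_simps)
    then have C: "A * C + norm B \<le> C" using A by (simp add: algebra_simps)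
    have C1: "C \<ge> 1" using A by (simp add: C_def)
    have A0: "A > 0" using m by (simp add: half_plane_model_def)
    have bd: "norm (cayley p ((g ^^ n) 0)) \<le> C" for n
    proof (induction n)
      case 0 then show ?case using C1 p by (simp add: cayley_def norm_divide)
    next
      case (Suc n)
      have "cayley p ((g ^^ Suc n) 0) = of_real A * cayley p ((g ^^ n) 0) + B"
        using m orbD by (simp add: half_plane_model_def)
      then have "norm (cayley p ((g ^^ Suc n) 0)) \<le> A * norm (cayley p ((g ^^ n) 0)) + norm B"
        using A0 norm_triangle_ineq[of "of_real A * cayley p ((g ^^ n) 0)" B] by (simp add: norm_mult)
      also have "\<dots> \<le> A * C + norm B" using Suc A0 by simp
      finally show ?case using C by linarith
    qed
    have "2 / (C + 1) \<le> norm ((g ^^ n) 0 - p)" for n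
    proof -
      have ne: "(g ^^ n) 0 \<noteq> p" using orbD[of n] p by auto
      have "2 / norm ((g ^^ n) 0 - p) = norm (cayley p ((g ^^ n) 0) + 1)"
        using cayley_plus_1[OF ne] p by (simp add: norm_divide norm_mult norm_minus_commute)
      also have "\<dots> \<le> C + 1" using bd[of n] norm_triangle_ineq[of "cayley p ((g ^^ n) 0)" 1] by simp
      finally show ?thesis using ne C1 by (simp add: field_simps)
    qed
    moreover have "(\<lambda>n. norm ((g ^^ n) 0 - p)) \<longlonglongrightarrow> 0"
      using tendsto_norm_zero[OF LIM_zero[OF lim]] .
    ultimately have "2 / (C + 1) \<le> 0" by (intro LIMSEQ_le_const) auto
    then show False using C1 by (simp add: field_simps)
  qed
  then show ?thesis using m that by blast
qed

section \<open>Intertwining at a boundary Denjoy-Wolff point\<close>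

lemma intertwining_iterate:
  assumes "self_map \<phi>" "\<forall>z\<in>unit_disc. f (\<phi> z) = \<psi> (f z)" "z \<in> unit_disc"
  shows "f ((\<phi> ^^ n) z) = (\<psi> ^^ n) (f z)"
  by (induction n) (use assms self_map_iterate in auto)

lemma automorphism_backward_orbit:
  assumes "disc_automorphism \<phi>" "z \<in> unit_disc"
  obtains u where "\<And>n. u n \<in> unit_disc" "\<And>n. (\<phi> ^^ n) (u n) = z"
proof -
  have "bij_betw (\<phi> ^^ n) unit_disc unit_disc" for n
    using assms(1) bij_betw_funpow by (auto simp: disc_automorphism_def)
  then have "\<exists>u\<in>unit_disc. (\<phi> ^^ n) u = z" for n
    using assms(2) by (metis bij_betw_imp_surj_on imageE)
  then show ?thesis using that by metis
qed

text \<open>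
  The situation of a non-elliptic \<open>\<phi>\<close>, with \<open>\<phi>\<close> already in half-plane form. The point \<open>q\<close> is the
  angular limit of \<open>f\<close> at \<open>p\<close>, and \<open>D\<close> its angular derivative there.
\<close>

locale boundary_intertwining =
  fixes \<phi> \<psi> f :: "complex \<Rightarrow> complex" and p q D B :: complex and A :: real
  assumes model: "half_plane_model \<phi> p A B" and A_ge_1: "A \<ge> 1"
    and lf_\<psi>: "linear_fractional_self_map \<psi>" and ni_\<psi>: "non_identity \<psi>"
    and self_map_f: "self_map f"
    and limit: "angular_tendsto f q p"
    and derivative: "angular_tendsto (\<lambda>z. (f z - q) / (z - p)) D p" "D \<noteq> 0"
    and intertwining: "\<forall>z\<in>unit_disc. f (\<phi> z) = \<psi> (f z)"
begin

lemma norm_p: "norm p = 1" and self_map_\<phi>: "self_map \<phi>"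
  using model by (auto simp: half_plane_model_def)

lemma self_map_\<psi>: "self_map \<psi>"
  using lf_\<psi> by (simp add: linear_fractional_self_map_def)

text \<open>
  The multiplier transfers from \<open>\<phi>\<close> to \<open>\<psi>\<close>. Along the radial sequence \<open>u n\<close>, the points
  \<open>v n = \<phi> (u n)\<close> also approach \<open>p\<close> non-tangentially, so \<open>f\<close> tends to \<open>q\<close> along both and \<open>\<psi>\<close> fixes
  \<open>q\<close>; comparing two expressions for the limit of \<open>(f (v n) - q) / (u n - p)\<close> gives
  \<open>\<mu> D = D / A\<close>.
\<close>

lemma fixed_point_form:
  obtains \<kappa> where "\<And>z. z \<in> unit_disc \<Longrightarrow>
    1 + \<kappa> * (z - q) \<noteq> 0 \<and> \<psi> z - q = 1 / of_real A * (z - q) / (1 + \<kappa> * (z - q))"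
proof -
  define u where "u n = cayley_inv p (0 + of_nat n * 1)" for n
  define v where "v n = cayley_inv p (B + of_nat n * of_real A)" for n
  note nn = affine_linear_growth[of 0 1] and vn = affine_linear_growth[of B "of_real A"]
  note along_u = angular_tendsto_sequentially[OF _ norm_p nn, folded u_def, simplified]
  note along_v = angular_tendsto_sequentially[OF _ norm_p vn, folded v_def]
  have A: "Re (of_real A) > 0" using A_ge_1 by simp
  have stolz: "stolz_region p M \<subseteq> unit_disc" for M by (auto simp: stolz_region_def)
  have uD: "u n \<in> unit_disc" if "n > 0" for n
    unfolding u_def using that by (intro cayley_inv_in_disc[OF norm_p]) simp
  have v: "\<phi> (u n) = v n" if "n > 0" for n
  proof -
    have "cayley p (\<phi> (u n)) = B + of_nat n * of_real A"
      using model uD[OF that] cayley_cayley_inv[OF norm_p, of "of_nat n"] that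
      by (simp add: half_plane_model_def u_def mult.commute add.commute)
    then show ?thesis
      using cayley_inv_cayley[OF norm_p self_mapD[OF self_map_\<phi> uD[OF that]]] by (simp add: v_def)
  qed
  have fv: "\<psi> (f (u n)) = f (v n)" if "n > 0" for n
    using intertwining uD[OF that] v[OF that] by metis
  have evpos: "eventually (\<lambda>n::nat. n > 0) sequentially" by (rule eventually_gt_at_top)
  have fu: "(\<lambda>n. f (u n)) \<longlonglongrightarrow> q" by (rule along_u[OF limit])
  have "(\<lambda>n. f (v n)) \<longlonglongrightarrow> q" by (rule along_v[OF limit A])
  then have psi: "(\<lambda>n. \<psi> (f (u n))) \<longlonglongrightarrow> q"
    by (rule Lim_transform_eventually) (use evpos in eventually_elim, simp add: fv)
  have fuD: "eventually (\<lambda>n. f (u n) \<in> unit_disc) sequentially"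
    using evpos by eventually_elim (intro self_mapD[OF self_map_f] uD)
  obtain \<mu> \<kappa> where \<mu>: "\<And>z. z \<in> unit_disc \<Longrightarrow>
      1 + \<kappa> * (z - q) \<noteq> 0 \<and> \<psi> z - q = \<mu> * (z - q) / (1 + \<kappa> * (z - q))"
    using linear_fractional_fixed_point_form[OF lf_\<psi> fuD fu psi] by metis
  have "angular_tendsto (\<lambda>z. (\<phi> z - p) / (z - p)) (1 / of_real A) p"
    using half_plane_model_angular_derivative(1)[OF model stolz] by (simp add: angular_tendsto_def)
  then have "(\<lambda>n. (f (v n) - q) / (v n - p) * ((\<phi> (u n) - p) / (u n - p))) \<longlonglongrightarrow> D * (1 / of_real A)"
    by (intro tendsto_mult along_u along_v[OF derivative(1) A])
  moreover have "eventually (\<lambda>n. (f (v n) - q) / (v n - p) * ((\<phi> (u n) - p) / (u n - p))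
      = \<mu> * ((f (u n) - q) / (u n - p)) / (1 + \<kappa> * (f (u n) - q))) sequentially"
    using evpos
  proof eventually_elim
    case (elim n)
    have "v n \<noteq> p" using self_mapD[OF self_map_\<phi> uD[OF elim]] v[OF elim] norm_p by auto
    then have "(f (v n) - q) / (v n - p) * ((\<phi> (u n) - p) / (u n - p)) = (\<psi> (f (u n)) - q) / (u n - p)"
      using v[OF elim] fv[OF elim] by simp
    also have "\<psi> (f (u n)) - q = \<mu> * (f (u n) - q) / (1 + \<kappa> * (f (u n) - q))"
      using \<mu>[OF self_mapD[OF self_map_f uD[OF elim]]] by blast
    finally show ?case by (simp add: mult.commute)
  qed
  ultimately have "(\<lambda>n. \<mu> * ((f (u n) - q) / (u n - p)) / (1 + \<kappa> * (f (u n) - q))) \<longlonglongrightarrow> D * (1 / of_real A)"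
    by (rule Lim_transform_eventually)
  moreover have "(\<lambda>n. \<mu> * ((f (u n) - q) / (u n - p)) / (1 + \<kappa> * (f (u n) - q))) \<longlonglongrightarrow> \<mu> * D / (1 + \<kappa> * (q - q))"
    by (intro tendsto_intros along_u[OF derivative(1)] fu) simp
  ultimately have "\<mu> * D = 1 / of_real A * D" using LIMSEQ_unique by fastforce
  then have "\<mu> = 1 / of_real A" using derivative(2) mult_right_cancel by blast
  with \<mu> show ?thesis using that by blast
qed

lemma not_constant: "\<exists>z\<in>unit_disc. f z \<noteq> q"
proof (rule ccontr)
  assume c: "\<not> (\<exists>z\<in>unit_disc. f z \<noteq> q)"
  have "angular_tendsto (\<lambda>z. (f z - q) / (z - p)) 0 p"
    unfolding angular_tendsto_def
  proof (intro allI impI)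
    fix M :: real
    have "eventually (\<lambda>z. (f z - q) / (z - p) = 0) (at p within stolz_region p M)"
      using c by (auto simp: eventually_at_filter stolz_region_def)
    then show "((\<lambda>z. (f z - q) / (z - p)) \<longlongrightarrow> 0) (at p within stolz_region p M)"
      by (rule tendsto_eventually)
  qed
  then show False using angular_tendsto_unique[OF derivative(1) _ norm_p] derivative(2) by blast
qed

text \<open>
  Multiplier \<open>1\<close> at an interior fixed point would make \<open>\<psi>\<close> the identity, so \<open>A\<close> exceeds \<open>1\<close>. For the
  last claim, \<open>f\<close> carries backward orbits of \<open>\<phi>\<close> to backward orbits of \<open>\<psi>\<close>, and these exist for a
  value other than \<open>q\<close> because \<open>f\<close> is not constant.
\<close>

lemma interior_limit:
  assumes q: "q \<in> unit_disc"
  shows "elliptic \<psi>" "\<not> disc_automorphism \<psi>" "A > 1"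
    and "disc_automorphism \<phi> \<Longrightarrow> closure (\<psi> ` unit_disc) \<inter> sphere 0 1 \<noteq> {}"
proof -
  obtain \<kappa> where "\<And>z. z \<in> unit_disc \<Longrightarrow>
      1 + \<kappa> * (z - q) \<noteq> 0 \<and> \<psi> z - q = 1 / of_real A * (z - q) / (1 + \<kappa> * (z - q))"
    by (metis fixed_point_form)
  then have fixed: "\<psi> q = q" and der: "deriv \<psi> q = 1 / of_real A"
    using multiplier_at_interior_fixed_point[OF q] by blast+
  show "elliptic \<psi>" using self_map_\<psi> ni_\<psi> q fixed by (auto simp: elliptic_def)
  have "A \<noteq> 1" using identity_if_multiplier_1[OF self_map_\<psi> q fixed] der ni_\<psi> by auto
  then show "A > 1" using A_ge_1 by simp
  then show "\<not> disc_automorphism \<psi>"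
    using automorphism_iff_unimodular_multiplier[OF self_map_\<psi> q fixed] der by (simp add: norm_divide)
  show "closure (\<psi> ` unit_disc) \<inter> sphere 0 1 \<noteq> {}" if aut: "disc_automorphism \<phi>"
  proof
    assume away: "closure (\<psi> ` unit_disc) \<inter> sphere 0 1 = {}"
    obtain z where z: "z \<in> unit_disc" "f z \<noteq> q" using not_constant by blast
    obtain u where u: "\<And>n. u n \<in> unit_disc" "\<And>n. (\<phi> ^^ n) (u n) = z"
      using automorphism_backward_orbit[OF aut z(1)] by blast
    have "(\<psi> ^^ n) (f (u n)) = f z" for n
      using intertwining_iterate[OF self_map_\<phi> intertwining u(1)] u(2) by metis
    then show False
      using backward_orbit_at_fixed_point[OF self_map_\<psi> q fixed away, of "\<lambda>n. f (u n)"]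
        self_mapD[OF self_map_f u(1)] z(2) by blast
  qed
qed

lemma boundary_limit:
  assumes q: "norm q = 1"
  obtains B' where "half_plane_model \<psi> q A B'"
proof -
  obtain \<kappa> where \<kappa>: "\<And>z. z \<in> unit_disc \<Longrightarrow>
      1 + \<kappa> * (z - q) \<noteq> 0 \<and> \<psi> z - q = 1 / of_real A * (z - q) / (1 + \<kappa> * (z - q))"
    by (metis fixed_point_form)
  have "1 / of_real A \<noteq> (0::complex)" using A_ge_1 by simp
  from half_plane_model_exists[OF self_map_\<psi> q this \<kappa>]
  obtain A' B' where m: "half_plane_model \<psi> q A' B'" "1 / of_real A = (1 / of_real A' :: complex)" by blast
  then have "A' = A" by simp
  then show ?thesis using m that by blast
qed

text \<open>
  Since \<open>\<phi>\<close> is onto, \<open>f 0\<close> is the \<open>n\<close>-th iterate under \<open>\<psi>\<close> of some point, for every \<open>n\<close>. Each step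
  of \<open>\<psi>\<close> raises the real part by at least \<open>Re B'\<close>, so the finite real part of \<open>f 0\<close> leaves no room
  for \<open>Re B' > 0\<close>.
\<close>

lemma automorphism_transfer:
  assumes m: "half_plane_model \<psi> q A B'" and aut: "disc_automorphism \<phi>"
  shows "disc_automorphism \<psi>"
proof -
  have q: "norm q = 1" and B': "Re B' \<ge> 0" using m by (auto simp: half_plane_model_def)
  obtain u where u: "\<And>n. u n \<in> unit_disc" "\<And>n. (\<phi> ^^ n) (u n) = 0"
    using automorphism_backward_orbit[OF aut, of 0] by auto
  have bound: "real n * Re B' \<le> Re (cayley q (f 0))" for n
  proof -
    define w where "w = cayley q (f (u n))"
    have fu: "f (u n) \<in> unit_disc" using self_mapD[OF self_map_f u(1)] .
    have w: "Re w > 0" unfolding w_def by (rule Re_cayley_pos[OF q fu])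
    obtain s where s: "s \<ge> real n"
      "cayley q ((\<psi> ^^ n) (f (u n))) = w + of_real s * ((of_real A - 1) * w + B')"
      using half_plane_model_iterate[OF m A_ge_1] fu unfolding w_def by metis
    have "(\<psi> ^^ n) (f (u n)) = f 0"
      using intertwining_iterate[OF self_map_\<phi> intertwining u(1)] u(2) by metis
    then have "Re (cayley q (f 0)) = Re w + s * ((A - 1) * Re w + Re B')" using s(2) by simp
    moreover have "s * ((A - 1) * Re w + Re B') \<ge> real n * Re B'"
      using s(1) A_ge_1 w B' by (intro mult_mono) auto
    ultimately show ?thesis using w by simp
  qed
  have "Re B' \<le> 0"
  proof (rule ccontr)
    assume "\<not> Re B' \<le> 0"
    then obtain n where "Re (cayley q (f 0)) < real n * Re B'"
      using reals_Archimedean3[of "Re B'"] by auto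
    then show False using bound[of n] by simp
  qed
  then show ?thesis using B' half_plane_model_automorphism_iff[OF m] by simp
qed

text \<open>
  In half-plane coordinates \<open>f\<close> becomes a map \<open>F\<close> with \<open>F (w + B) = F w + B'\<close>, and conformality says
  that \<open>F w\<close> is asymptotic to \<open>c w\<close> in sectors, with \<open>c \<noteq> 0\<close>. Along \<open>1 + n B\<close>, which stays in a
  sector as \<open>Re B > 0\<close>, this identifies \<open>c\<close> as \<open>B' / B\<close>; along \<open>n e\<close> for all directions \<open>e\<close> it
  shows that \<open>w \<mapsto> c w\<close> preserves the closed half-plane, so \<open>c\<close> is real and positive.
\<close>

lemma parabolic_non_automorphism_transfer:
  assumes m: "half_plane_model \<psi> q A B'" and A1: "A = 1" and B: "Re B > 0"
  shows "Re B' > 0"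
proof -
  have q: "norm q = 1" using m by (simp add: half_plane_model_def)
  have p0: "p \<noteq> 0" "q \<noteq> 0" using norm_p q by auto
  define F where "F w = cayley q (f (cayley_inv p w))" for w
  \<comment> \<open>The half-plane slope of \<open>f\<close>, from \<open>w + 1 = 2 p / (p - z)\<close> and \<open>F w + 1 = 2 q / (q - f z)\<close>.\<close>
  define c where "c = q / p / D"
  have fD: "f (cayley_inv p w) \<in> unit_disc" if "Re w > 0" for w
    using self_mapD[OF self_map_f cayley_inv_in_disc[OF norm_p that]] .
  have F_pos: "Re (F w) > 0" if "Re w > 0" for w
    unfolding F_def by (rule Re_cayley_pos[OF q fD[OF that]])
  have ratio: "(\<lambda>n. (F (w n) + 1) / (w n + 1)) \<longlonglongrightarrow> c"
    if w: "(\<lambda>n. w n / of_nat n) \<longlonglongrightarrow> e" "Re e > 0" for w e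
  proof -
    have "(\<lambda>n. q / p / ((f (cayley_inv p (w n)) - q) / (cayley_inv p (w n) - p))) \<longlonglongrightarrow> c"
      unfolding c_def
      by (intro tendsto_intros angular_tendsto_sequentially[OF derivative(1) norm_p w] derivative(2))
    moreover have "eventually (\<lambda>n. q / p / ((f (cayley_inv p (w n)) - q) / (cayley_inv p (w n) - p))
        = (F (w n) + 1) / (w n + 1)) sequentially"
      using eventually_Re_pos_linear_growth[OF w]
    proof eventually_elim
      case (elim n)
      define z where "z = cayley_inv p (w n)"
      have z: "z \<noteq> p" "f z \<noteq> q"
        using cayley_inv_in_disc[OF norm_p elim] fD[OF elim] norm_p q by (auto simp: z_def)
      have "w n + 1 = 2 * p / (p - z)"
        using cayley_plus_1[OF z(1)] cayley_cayley_inv[OF norm_p elim] by (simp add: z_def)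
      moreover have "F (w n) + 1 = 2 * q / (q - f z)"
        using cayley_plus_1[OF z(2)] by (simp add: F_def z_def)
      ultimately have "(F (w n) + 1) / (w n + 1) = (2 * q / (q - f z)) / (2 * p / (p - z))" by simp
      also have "\<dots> = q / p / ((f z - q) / (z - p))"
        using z p0 by (simp add: divide_simps) (simp add: algebra_simps)
      finally show ?case by (simp add: z_def)
    qed
    ultimately show ?thesis by (rule Lim_transform_eventually)
  qed
  have B0: "B \<noteq> 0" using B by auto
  have translation: "F (1 + of_nat n * B) = F 1 + of_nat n * B'" for n
  proof (induction n)
    case (Suc n)
    define w where "w = 1 + of_nat n * B"
    have w: "Re w > 0" using B by (simp add: w_def add_pos_nonneg)
    have D: "cayley_inv p w \<in> unit_disc" by (rule cayley_inv_in_disc[OF norm_p w])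
    have "cayley p (\<phi> (cayley_inv p w)) = w + B"
      using model D cayley_cayley_inv[OF norm_p w] by (simp add: half_plane_model_def A1)
    then have "\<phi> (cayley_inv p w) = cayley_inv p (w + B)"
      using cayley_inv_cayley[OF norm_p self_mapD[OF self_map_\<phi> D]] by simp
    then have "F (w + B) = cayley q (\<psi> (f (cayley_inv p w)))" using intertwining D by (metis F_def)
    also have "\<dots> = F w + B'"
      using m fD[OF w] by (simp add: half_plane_model_def A1 F_def)
    finally show ?case using Suc by (simp add: w_def algebra_simps)
  qed simp
  have cB: "c = B' / B"
  proof -
    have "(\<lambda>n. (F 1 + 1 + of_nat n * B') / of_nat n / ((2 + of_nat n * B) / of_nat n)) \<longlonglongrightarrow> B' / B"
      by (intro tendsto_divide affine_linear_growth B0)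
    then have "(\<lambda>n. (F (1 + of_nat n * B) + 1) / (1 + of_nat n * B + 1)) \<longlonglongrightarrow> B' / B"
    proof (rule Lim_transform_eventually)
      have shift: "1 + of_nat n * B + 1 = 2 + of_nat n * B"
        "F (1 + of_nat n * B) + 1 = F 1 + 1 + of_nat n * B'" for n by (simp_all add: translation)
      show "eventually (\<lambda>n. (F 1 + 1 + of_nat n * B') / of_nat n / ((2 + of_nat n * B) / of_nat n)
          = (F (1 + of_nat n * B) + 1) / (1 + of_nat n * B + 1)) sequentially"
        using eventually_gt_at_top[of 0] unfolding shift by eventually_elim simp
    qed
    then show ?thesis using ratio[OF affine_linear_growth[of 1 B] B] LIMSEQ_unique by blast
  qed
  \<comment> \<open>The summand 0 brings the claim into the shape \<open>a * w + b\<close>.\<close>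
  have "Re (c * e + 0) \<ge> 0" if e: "Re e > 0" for e
  proof -
    have "(\<lambda>n. (F (0 + of_nat n * e) + 1) / (0 + of_nat n * e + 1) * ((1 + of_nat n * e) / of_nat n)) \<longlonglongrightarrow> c * e"
      by (intro tendsto_mult ratio[OF affine_linear_growth e] affine_linear_growth)
    then have "(\<lambda>n. Re ((F (0 + of_nat n * e) + 1) / (0 + of_nat n * e + 1) * ((1 + of_nat n * e) / of_nat n)))
      \<longlonglongrightarrow> Re (c * e)" by (rule tendsto_Re)
    moreover have "eventually (\<lambda>n. 0 \<le> Re ((F (0 + of_nat n * e) + 1) / (0 + of_nat n * e + 1) * ((1 + of_nat n * e) / of_nat n))) sequentially"
      using eventually_gt_at_top[of 0]
    proof eventually_elim
      case (elim n)
      have pos: "Re (of_nat n * e) > 0" using e elim by simp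
      then have "Re (1 + of_nat n * e) > 0" by simp
      then have "1 + of_nat n * e \<noteq> 0" by (metis less_irrefl zero_complex.sel(1))
      then have "(F (0 + of_nat n * e) + 1) / (0 + of_nat n * e + 1) * ((1 + of_nat n * e) / of_nat n)
        = (F (of_nat n * e) + 1) / of_nat n" by (simp add: add.commute)
      then show ?case using F_pos[OF pos] elim by simp
    qed
    ultimately have "0 \<le> Re (c * e)" by (rule tendsto_lowerbound) simp
    then show ?thesis by simp
  qed
  note co = affine_half_plane_coefficients[OF this]
  have c: "c = of_real (Re c)" using co(1) by (simp add: complex_eq_iff)
  have "c \<noteq> 0" using p0 derivative(2) by (simp add: c_def)
  then have "Re c > 0" using co(2) c by (metis less_eq_real_def of_real_0)
  moreover have "B' = of_real (Re c) * B" using cB c B0 by (simp add: field_simps)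
  ultimately show ?thesis using B by simp
qed

end

theorem theorem3:
  fixes \<phi> \<psi> f :: "complex \<Rightarrow> complex" and p :: complex
  assumes "linear_fractional_self_map \<phi>" and "non_identity \<phi>"
    and "linear_fractional_self_map \<psi>" and "non_identity \<psi>"
    and "self_map f"
    and "denjoy_wolff_point \<phi> p"
    and "conformal_at f p"
    and "\<forall>z\<in>unit_disc. f (\<phi> z) = \<psi> (f z)"
  shows
    "(elliptic \<phi> \<and> \<not> disc_automorphism \<phi> \<longrightarrow> elliptic \<psi> \<and> \<not> disc_automorphism \<psi>) \<and>
     (elliptic \<psi> \<and> \<not> disc_automorphism \<psi> \<longrightarrow>
        hyperbolic \<phi> \<or> (elliptic \<phi> \<and> \<not> disc_automorphism \<phi>)) \<and>
     (elliptic \<phi> \<and> disc_automorphism \<phi> \<longleftrightarrow> elliptic \<psi> \<and> disc_automorphism \<psi>) \<and>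
     (hyperbolic \<psi> \<longrightarrow> hyperbolic \<phi>) \<and>
     ((hyperbolic \<phi> \<longrightarrow> hyperbolic \<psi> \<or> (elliptic \<psi> \<and> \<not> disc_automorphism \<psi>)) \<and>
      (hyperbolic \<phi> \<and> disc_automorphism \<phi> \<longrightarrow>
         (hyperbolic \<psi> \<and> disc_automorphism \<psi>) \<or>
         (elliptic \<psi> \<and> \<not> disc_automorphism \<psi> \<and>
          closure (\<psi> ` unit_disc) \<inter> sphere 0 1 \<noteq> {}))) \<and>
     (parabolic \<phi> \<and> \<not> disc_automorphism \<phi> \<longleftrightarrow> parabolic \<psi> \<and> \<not> disc_automorphism \<psi>) \<and>
     (parabolic \<phi> \<and> disc_automorphism \<phi> \<longleftrightarrow> parabolic \<psi> \<and> disc_automorphism \<psi>)"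
proof -
  have self: "self_map \<phi>" "self_map \<psi>"
    using assms(1,3) by (simp_all add: linear_fractional_self_map_def)
  have exclusive: "\<not> (hyperbolic g \<and> elliptic g)" "\<not> (parabolic g \<and> elliptic g)" for g
    by (auto simp: hyperbolic_def parabolic_def)
  show ?thesis
  proof (cases "elliptic \<phi>")
    case True
    then have p: "p \<in> unit_disc" "\<phi> p = p"
      using assms(6) by (auto simp: denjoy_wolff_point_def elliptic_def split: if_splits)
    then have f': "deriv f p \<noteq> 0" using assms(7) by (auto simp: conformal_at_def)
    have fp: "f p \<in> unit_disc" using self_mapD[OF assms(5) p(1)] .
    have fixed: "\<psi> (f p) = f p" using assms(8) p by metis
    have diff: "g field_differentiable at z" if "self_map g" "z \<in> unit_disc" for g z
      using that by (auto simp: self_map_def intro: holomorphic_on_imp_differentiable_at)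
    have "deriv (f \<circ> \<phi>) p = deriv (\<psi> \<circ> f) p"
    proof (rule complex_derivative_transform_within_open[of _ unit_disc])
      show "f \<circ> \<phi> holomorphic_on unit_disc" "\<psi> \<circ> f holomorphic_on unit_disc"
        using self assms(5) by (auto simp: self_map_def intro: holomorphic_on_compose_gen)
    qed (use assms(8) p in auto)
    moreover have "deriv (f \<circ> \<phi>) p = deriv f p * deriv \<phi> p"
      using deriv_chain[of \<phi> p f] diff self assms(5) p by simp
    moreover have "deriv (\<psi> \<circ> f) p = deriv \<psi> (f p) * deriv f p"
      using deriv_chain[of f p \<psi>] diff self assms(5) p fp by simp
    ultimately have "deriv \<psi> (f p) = deriv \<phi> p" using f' by simp
    then have "disc_automorphism \<phi> \<longleftrightarrow> disc_automorphism \<psi>"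
      using automorphism_iff_unimodular_multiplier[OF self(1) p]
        automorphism_iff_unimodular_multiplier[OF self(2) fp fixed] by simp
    moreover have "elliptic \<psi>" using self assms(4) fp fixed by (auto simp: elliptic_def)
    ultimately show ?thesis using True exclusive by blast
  next
    case False
    obtain A B where model: "half_plane_model \<phi> p A B" and A: "A \<ge> 1"
      using half_plane_model_at_denjoy_wolff_point[OF assms(1) False assms(6)] by blast
    have "norm p = 1" using model by (simp add: half_plane_model_def)
    then obtain D q where q: "D \<noteq> 0" "q \<in> cball 0 1" "angular_tendsto f q p"
        "angular_tendsto (\<lambda>z. (f z - q) / (z - p)) D p"
      using assms(7) by (auto simp: conformal_at_def has_angular_derivative_def)
    interpret boundary_intertwining \<phi> \<psi> f p q D B A
      using model A assms q by unfold_locales auto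
    note type_\<phi> = half_plane_model_hyperbolic_parabolic_iff[OF model A assms(2)]
    show ?thesis
    proof (cases "q \<in> unit_disc")
      case True
      note interior_limit[OF True]
      then show ?thesis using False exclusive type_\<phi> by fastforce
    next
      case q_boundary: False
      then have "norm q = 1" using q(2) by simp
      then obtain B' where m: "half_plane_model \<psi> q A B'" by (rule boundary_limit)
      note type_\<psi> = half_plane_model_hyperbolic_parabolic_iff[OF m A assms(4)]
      have "\<not> elliptic \<psi>" using half_plane_model_denjoy_wolff_point(1)[OF m A assms(4)] .
      moreover have "disc_automorphism \<phi> \<Longrightarrow> disc_automorphism \<psi>" by (rule automorphism_transfer[OF m])
      moreover have "disc_automorphism \<psi> \<Longrightarrow> disc_automorphism \<phi>" if "A = 1"
        using parabolic_non_automorphism_transfer[OF m that] half_plane_model_automorphism_iff[OF m]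
          half_plane_model_automorphism_iff[OF model] model
        by (auto simp: half_plane_model_def)
      ultimately show ?thesis using False type_\<phi> type_\<psi> by blast
    qed
  qed
qed

end
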